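(* Let $\mathcal X$ be an arbitrary set, let $\mathcal C=\{\nu_i:i\ge 1\}$ be a countable class of uniformly bounded conditional probability densities on $\mathbb R$ given $x\in\mathcal X$, with prior weights $w_\nu>0$, $\sum_{\nu\in\mathcal C}w_\nu=1$ (as specified in the context), and assume that the true distribution $\mu$ satisfies $\mu\in\mathcal C$. Then for every input sequence $x_{<\infty}\in\mathcal X^\infty$, all three MDL predictors $\psi\in\{\bar\varrho,\varrho,\varrho^{\mathrm{static}}\}$ (normalized dynamic, dynamic, static) converge to the true density $\mu$ in mean Hellinger sum, i.e. there is $R>0$ such that $H^2_{x_{<\infty}}(\mu,\psi)\le R$. In particular, $$H^2_{x_{<\infty}}(\mu,\varrho^{\mathrm{static}})\le 21\,w_\mu^{-1}.$$
   Context: Setup. $\mathcal X$ is an arbitrary set. $\mathcal C=\{\nu_i:i\ge1\}$ is a countable class of models, each a function from $\mathcal X$ to probability densities (w.r.t. Lebesgue measure) on $\mathbb R$, and there is a constant $C>0$ such that $0\le\nu_i(y|x)\le C$ and $\int_{-\infty}^\infty\nu_i(y|x)\,dy=1$ for all $i\ge1$, $x\in\mathcal X$, $y\in\mathbb R$. Each $\nu\in\mathcal C$ has a prior weight $w_\nu>0$, with $\sum_{\nu\in\mathcal C}w_\nu=1$. Notation: $x_{1:n}=(x_1,\ldots,x_n)$, $x_{<n}=x_{1:n-1}$, $x_{<\infty}=(x_1,x_2,\ldots)$, and similarly for $y$. Each $\nu\in\mathcal C$ induces a density on $\mathbb R^n$ by $\nu(y_{1:n}|x_{1:n})=\prod_{t=1}^n\nu(y_t|x_t)$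 (equal to $1$ for $n=0$), and its prediction is $\nu(y_n|x_{1:n},y_{<n})=\nu(y_n|x_n)$. Data: given the input sequence $x_1,x_2,\ldots$, the outputs $y_t$ are sampled independently, $y_t\sim\mu(\cdot|x_t)$, where $\mu$ is the true distribution. $\mathbf E$ denotes expectation with respect to $\mu$ (for the fixed input sequence). MDL estimator: $\nu^*_{(x_{1:n},y_{1:n})}=\arg\max_{\nu\in\mathcal C}\{w_\nu\nu(y_{1:n}|x_{1:n})\}$ (the maximum exists; ties are broken by a fixed measurable rule, e.g. smallest index), and $\varrho(y_{1:n}|x_{1:n})=\max_{\nu\in\mathcal C}\{w_\nu\nu(y_{1:n}|x_{1:n})\}$; for $n=0$, $\varrho(\emptyset)=\max_\nu w_\nu$. Predictors: - static MDL: $\varrho^{\mathrm{static}}(y_n|x_{1:n},y_{<n})=\nu^*_{(x_{<n},y_{<n})}(y_n|x_n)$; - dynamic MDL: $\varrho(y_n|x_{1:n},y_{<n})=\dfrac{\varrho(y_{1:n}|x_{1:n})}{\varrho(y_{<n}|x_{<n})}$ (not necessarily of total mass $1$); - normalized dynamic MDL: $\bar\varrho(y_n|x_{1:n},y_{<n})=\dfrac{\varrho(y_{1:n}|x_{1:n})}{\int\varrho(y_{1:n}|x_{1:n})\,dy_n}$. The fractions are well defined except on a set of $\mu$-measure zero of histories. Cumulative Hellinger distance: for a predictor $\psi$, $$H^2_{x_{<\infty}}(\mu,\psi)=\sum_{t=1}^\infty\mathbf E\int_{\mathbb R}\Big(\sqrt{\mu(y_t|x_{1:t},y_{<t})}-\sqrt{\psi(y_t|x_{1:t},y_{<t})}\Big)^2dy_t.$$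 *)

theory Defs
  imports "HOL-Probability.Probability"
begin

type_synonym 'x model = "'x \<Rightarrow> real \<Rightarrow> real"

text \<open>Sequences start at index 0, so step \<open>t\<close> uses the inputs \<open>x 0, \<dots>, x t\<close> and the past outputs
  \<open>y 0, \<dots>, y (t - 1)\<close>. A predictor maps the list of inputs up to and including the current one
  and the list of past outputs (one shorter) to a function of the current output.\<close>

type_synonym 'x predictor = "'x list \<Rightarrow> real list \<Rightarrow> real \<Rightarrow> real"

definition seq_density :: "'x model \<Rightarrow> 'x list \<Rightarrow> real list \<Rightarrow> real" where
  "seq_density \<nu> xs ys = (\<Prod>(x, y)\<leftarrow>zip xs ys. \<nu> x y)"

definition model_pred :: "'x model \<Rightarrow> 'x predictor" where
  "model_pred \<nu> xs ys y = \<nu> (last xs) y"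

text \<open>Under the standing assumptions the supremum is a maximum, see
  \<open>arg_max_exists\<close> and \<open>mdl_density_attained\<close>.\<close>

definition mdl_density :: "'x model set \<Rightarrow> ('x model \<Rightarrow> real) \<Rightarrow> 'x list \<Rightarrow> real list \<Rightarrow> real" where
  "mdl_density C w xs ys = (SUP \<nu>\<in>C. w \<nu> * seq_density \<nu> xs ys)"

text \<open>An MDL estimator is any measurable way of selecting a maximizer; no particular tie-breaking
  rule is fixed. Smallest index works, see \<open>mdl_estimator_exists\<close>.\<close>

definition mdl_estimator ::
  "'x model set \<Rightarrow> ('x model \<Rightarrow> real) \<Rightarrow> ('x list \<Rightarrow> real list \<Rightarrow> 'x model) \<Rightarrow> bool" where
  "mdl_estimator C w est \<longleftrightarrow>
     (\<forall>xs ys. length xs = length ys \<longrightarrow>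
        is_arg_max (\<lambda>\<nu>. w \<nu> * seq_density \<nu> xs ys) (\<lambda>\<nu>. \<nu> \<in> C) (est xs ys)) \<and>
     (\<forall>xs. (\<lambda>y. est xs (map y [0..<length xs]))
        \<in> (\<Pi>\<^sub>M i\<in>{..<length xs}. borel) \<rightarrow>\<^sub>M count_space C)"

definition mdl_static :: "('x list \<Rightarrow> real list \<Rightarrow> 'x model) \<Rightarrow> 'x predictor" where
  "mdl_static est xs ys y = est (butlast xs) ys (last xs) y"

definition mdl_dynamic :: "'x model set \<Rightarrow> ('x model \<Rightarrow> real) \<Rightarrow> 'x predictor" where
  "mdl_dynamic C w xs ys y = mdl_density C w xs (ys @ [y]) / mdl_density C w (butlast xs) ys"

definition mdl_normalized :: "'x model set \<Rightarrow> ('x model \<Rightarrow> real) \<Rightarrow> 'x predictor" where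
  "mdl_normalized C w xs ys y =
     mdl_density C w xs (ys @ [y]) / (\<integral>z. mdl_density C w xs (ys @ [z]) \<partial>lborel)"

definition output_law :: "'x model \<Rightarrow> (nat \<Rightarrow> 'x) \<Rightarrow> (nat \<Rightarrow> real) measure" where
  "output_law \<mu> x = (\<Pi>\<^sub>M t\<in>UNIV. density lborel (\<lambda>z. ennreal (\<mu> (x t) z)))"

definition hellinger_sum :: "(nat \<Rightarrow> 'x) \<Rightarrow> 'x model \<Rightarrow> 'x predictor \<Rightarrow> ennreal" where
  "hellinger_sum x \<mu> \<psi> =
     (\<Sum>t. \<integral>\<^sup>+y. (\<integral>\<^sup>+z. ennreal
          ((sqrt (model_pred \<mu> (map x [0..<Suc t]) (map y [0..<t]) z)
            - sqrt (\<psi> (map x [0..<Suc t]) (map y [0..<t]) z))\<^sup>2) \<partial>lborel) \<partial>output_law \<mu> x)"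

lemma seq_density_bounds:
  assumes "\<And>x y. 0 \<le> \<nu> x y \<and> \<nu> x y \<le> B" and "length xs = length ys"
  shows "0 \<le> seq_density \<nu> xs ys \<and> seq_density \<nu> xs ys \<le> B ^ length xs"
  using assms(2)
proof (induction xs ys rule: list_induct2)
  case Nil
  show ?case by (simp add: seq_density_def)
next
  case (Cons x xs y ys)
  have "0 \<le> B" using assms(1) order_trans by blast
  moreover have "seq_density \<nu> (x # xs) (y # ys) = \<nu> x y * seq_density \<nu> xs ys"
    by (simp add: seq_density_def)
  ultimately show ?case
    using Cons assms(1)[of x y] by (auto intro!: mult_mono)
qed

lemma arg_max_exists:
  fixes C :: "'x model set"
  assumes bounds: "\<And>\<nu> x y. \<nu> \<in> C \<Longrightarrow> 0 \<le> \<nu> x y \<and> \<nu> x y \<le> B"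
    and pos: "\<And>\<nu>. \<nu> \<in> C \<Longrightarrow> 0 < w \<nu>"
    and sum: "(w has_sum 1) C"
    and len: "length xs = length ys"
  shows "\<exists>\<nu>. is_arg_max (\<lambda>\<nu>. w \<nu> * seq_density \<nu> xs ys) (\<lambda>\<nu>. \<nu> \<in> C) \<nu>"
proof -
  define f where "f \<nu> = w \<nu> * seq_density \<nu> xs ys" for \<nu>
  define b where "b = B ^ length xs"
  have sd: "0 \<le> seq_density \<nu> xs ys" "seq_density \<nu> xs ys \<le> b" if "\<nu> \<in> C" for \<nu>
    using seq_density_bounds[OF bounds[OF that] len] by (auto simp: b_def)
  have "C \<noteq> {}"
  proof
    assume "C = {}"
    then have "(w has_sum 0) C" by simp
    with sum have "(1::real) = 0" by (rule has_sum_unique)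
    then show False by simp
  qed
  show ?thesis
  proof (cases "\<exists>\<nu>\<in>C. 0 < f \<nu>")
    case False
    obtain \<nu>0 where "\<nu>0 \<in> C" using \<open>C \<noteq> {}\<close> by blast
    moreover have "0 \<le> f \<nu>0"
      using \<open>\<nu>0 \<in> C\<close> pos[of \<nu>0] sd(1)[of \<nu>0] by (simp add: f_def)
    ultimately have "is_arg_max f (\<lambda>\<nu>. \<nu> \<in> C) \<nu>0"
      using False by (force simp: is_arg_max_def)
    then show ?thesis unfolding f_def by blast
  next
    case True
    then obtain \<nu>0 where \<nu>0: "\<nu>0 \<in> C" "0 < f \<nu>0" by blast
    define A where "A = {\<nu>\<in>C. f \<nu>0 \<le> f \<nu>}"
    have b: "0 < b"
      using \<nu>0 pos[OF \<nu>0(1)] sd[OF \<nu>0(1)] by (auto simp: f_def zero_less_mult_iff)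
    have "finite A"
    proof (rule ccontr)
      assume inf: "infinite A"
      define e where "e = f \<nu>0 / b"
      have e: "0 < e" using b \<nu>0 by (simp add: e_def)
      obtain F where F: "finite F" "F \<subseteq> A" "card F = nat \<lceil>1 / e\<rceil> + 1"
        using inf infinite_arbitrarily_large by blast
      have we: "e \<le> w \<nu>" if "\<nu> \<in> F" for \<nu>
      proof -
        have m: "\<nu> \<in> C" "f \<nu>0 \<le> f \<nu>" using that F by (auto simp: A_def)
        have "f \<nu> \<le> w \<nu> * b"
          unfolding f_def using sd[OF m(1)] pos[OF m(1)] by (intro mult_left_mono) auto
        with m b show ?thesis by (simp add: e_def divide_simps)
      qed
      have "real (card F) * e \<le> sum w F"
        using sum_bounded_below[of F e w] we by simp
      also have "sum w F \<le> 1"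
      proof (rule has_sum_mono_neutral[OF has_sum_finite[OF F(1)] sum])
        show "\<And>\<nu>. \<nu> \<in> C - F \<Longrightarrow> 0 \<le> w \<nu>" using pos by (simp add: less_imp_le)
        show "\<And>\<nu>. \<nu> \<in> F - C \<Longrightarrow> w \<nu> \<le> 0" using F(2) by (auto simp: A_def)
      qed simp
      finally have "real (card F) \<le> 1 / e" using e by (simp add: field_simps)
      with F(3) e show False by linarith
    qed
    moreover have "A \<noteq> {}" using \<nu>0 by (auto simp: A_def)
    ultimately have "Max (f ` A) \<in> f ` A" by (intro Max_in) auto
    then obtain m where m': "m \<in> A" "f m = Max (f ` A)" by force
    then have m: "m \<in> A" "\<And>\<nu>. \<nu> \<in> A \<Longrightarrow> f \<nu> \<le> f m"
      using \<open>finite A\<close> by auto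
    have "f \<nu> \<le> f m" if "\<nu> \<in> C" for \<nu>
      using m that by (cases "\<nu> \<in> A") (auto simp: A_def)
    then show ?thesis
      using m(1) unfolding is_arg_max_def f_def[symmetric] by (auto simp: not_less A_def)
  qed
qed

lemma mdl_density_attained:
  assumes "is_arg_max (\<lambda>\<nu>. w \<nu> * seq_density \<nu> xs ys) (\<lambda>\<nu>. \<nu> \<in> C) \<nu>"
  shows "mdl_density C w xs ys = w \<nu> * seq_density \<nu> xs ys"
  using assms unfolding mdl_density_def is_arg_max_def
  by (intro cSup_eq_maximum) (auto simp: not_less)


lemma mdl_estimator_exists:
  fixes C :: "'x model set"
  assumes "countable C"
    and meas: "\<And>\<nu> u. \<nu> \<in> C \<Longrightarrow> \<nu> u \<in> borel_measurable borel"
    and bounds: "\<And>\<nu> x y. \<nu> \<in> C \<Longrightarrow> 0 \<le> \<nu> x y \<and> \<nu> x y \<le> B"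
    and pos: "\<And>\<nu>. \<nu> \<in> C \<Longrightarrow> 0 < w \<nu>"
    and sum: "(w has_sum 1) C"
  shows "\<exists>est. mdl_estimator C w est"
proof -
  define M where "M xs ys = is_arg_max (\<lambda>\<nu>. w \<nu> * seq_density \<nu> xs ys) (\<lambda>\<nu>. \<nu> \<in> C)" for xs ys
  have ex: "\<exists>\<nu>. M xs ys \<nu>" if "length xs = length ys" for xs ys
    unfolding M_def by (rule arg_max_exists[where B = B]) (use bounds pos sum that in auto)
  define est where "est xs ys = from_nat_into C (LEAST n. M xs ys (from_nat_into C n))" for xs ys
  have "C \<noteq> {}"
    using ex[of "[]" "[]"] by (auto simp: M_def is_arg_max_def)
  have inC: "from_nat_into C n \<in> C" for n
    using \<open>C \<noteq> {}\<close> by (rule from_nat_into)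
  have "M xs ys (est xs ys)" if len: "length xs = length ys" for xs ys
  proof -
    obtain \<nu> where "M xs ys \<nu>"
      using ex[OF len] by blast
    moreover from this have "\<nu> \<in> C" by (simp add: M_def is_arg_max_def)
    ultimately have "M xs ys (from_nat_into C (to_nat_on C \<nu>))"
      using \<open>countable C\<close> by simp
    then show ?thesis unfolding est_def by (rule LeastI)
  qed
  moreover have "(\<lambda>y. est xs (map y [0..<length xs]))
      \<in> (\<Pi>\<^sub>M i\<in>{..<length xs}. borel) \<rightarrow>\<^sub>M count_space C" for xs
  proof -
    let ?P = "\<Pi>\<^sub>M i\<in>{..<length xs}. (borel :: real measure)"
    have sd: "seq_density \<nu> xs (map y [0..<length xs]) = (\<Prod>i<length xs. \<nu> (xs ! i) (y i))" for \<nu> y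
    proof -
      have "zip xs (map y [0..<length xs]) = map (\<lambda>i. (xs ! i, y i)) [0..<length xs]"
        by (auto intro!: nth_equalityI)
      then show ?thesis
        by (simp add: seq_density_def o_def prod.distinct_set_conv_list[symmetric] atLeast0LessThan)
    qed
    define g where "g n y = seq_density (from_nat_into C n) xs (map y [0..<length xs])" for n y
    have g: "g n \<in> borel_measurable ?P" for n
      unfolding g_def sd
    proof (rule borel_measurable_prod)
      fix i assume "i \<in> {..<length xs}"
      then have "(\<lambda>y. y i) \<in> ?P \<rightarrow>\<^sub>M borel" by (rule measurable_component_singleton)
      then show "(\<lambda>y. from_nat_into C n (xs ! i) (y i)) \<in> borel_measurable ?P"
        by (rule measurable_compose) (rule meas[OF inC])
    qed
    have M_iff: "M xs ys (from_nat_into C n) \<longleftrightarrow>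
        (\<forall>m. w (from_nat_into C m) * seq_density (from_nat_into C m) xs ys
          \<le> w (from_nat_into C n) * seq_density (from_nat_into C n) xs ys)" for ys n
    proof -
      have all_C: "(\<forall>\<nu>\<in>C. Q \<nu>) \<longleftrightarrow> (\<forall>m. Q (from_nat_into C m))" for Q
        using range_from_nat_into[OF \<open>C \<noteq> {}\<close> \<open>countable C\<close>] by (metis inC rangeE)
      show ?thesis
        using all_C[of "\<lambda>\<nu>. w \<nu> * seq_density \<nu> xs ys
          \<le> w (from_nat_into C n) * seq_density (from_nat_into C n) xs ys"]
        unfolding M_def is_arg_max_def by (auto simp: inC not_less)
    qed
    have "(\<lambda>y. LEAST n. M xs (map y [0..<length xs]) (from_nat_into C n)) \<in> ?P \<rightarrow>\<^sub>M count_space UNIV"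
      unfolding M_iff g_def[symmetric]
      by (intro measurable_Least pred_intros_countable) (unfold pred_def,
          intro borel_measurable_le borel_measurable_times borel_measurable_const g)
    then show ?thesis
      unfolding est_def by (rule measurable_compose) (auto simp: inC)
  qed
  ultimately show ?thesis
    unfolding mdl_estimator_def M_def by blast
qed

end

theory Submission
  imports Defs
begin

text \<open>All three predictors \<open>\<psi>\<close> are dominated by the dynamic one and have total mass at least \<open>1\<close>;
  this alone bounds their Hellinger sum. With \<open>m\<close>, \<open>d\<close> the \<open>\<mu>\<close>- and MDL-density of the past
  outputs, \<open>j\<close> the integral of the next MDL-density \<open>d'\<close> over the new output and
  \<open>g = \<integral> sqrt (\<mu> d')\<close>, the squared distance at one step is at most \<open>4 j / d - 4 g / sqrt d\<close>.
  As \<open>w m \<le> d\<close>, the weight \<open>m\<close> of the past is at most \<open>sqrt (m d) / sqrt w\<close> and \<open>d / w\<close>, so the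
  expected distance is at most the decrease of \<open>(4 / sqrt w) \<integral> sqrt (m d)\<close> plus the increase of
  \<open>(4 / w) \<integral> d\<close>. Both integrals lie between \<open>0\<close> and \<open>1\<close>, so the sum over all steps telescopes to
  at most \<open>4 / sqrt w + 4 / w \<le> 8 / w\<close>.\<close>

section \<open>Real inequalities behind a single step\<close>

text \<open>With \<open>a\<close>, \<open>b\<close>, \<open>q\<close> the roots of \<open>m\<close>,
  \<open>p\<close>, \<open>f\<close>, pass through \<open>q\<close>: \<open>(a - b)\<^sup>2\<close>
  is at most \<open>2 * (a - q)\<^sup>2 + 2 * (q - b)\<^sup>2\<close>, and the last square is at
  most \<open>q\<^sup>2 - b\<^sup>2\<close> because \<open>b \<le> q\<close>. After integration the
  terms \<open>2 * m\<close> and \<open>- 2 * p\<close> cancel up to sign when \<open>m\<close> has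
  mass 1 and \<open>p\<close> at least 1.\<close>

lemma hellinger_dominated_pointwise:
  fixes m p f :: real
  assumes "0 \<le> m" "0 \<le> p" "p \<le> f"
  shows "(sqrt m - sqrt p)\<^sup>2 \<le> 2 * m + 4 * f - 4 * sqrt (m * f) - 2 * p"
proof -
  define a b q where "a = sqrt m" and "b = sqrt p" and "q = sqrt f"
  have sq: "m = a\<^sup>2" "p = b\<^sup>2" "f = q\<^sup>2" "0 \<le> a" "0 \<le> b" "b \<le> q"
    using assms by (auto simp: a_def b_def q_def)
  have "(a - b)\<^sup>2 \<le> 2 * (a - q)\<^sup>2 + 2 * (q - b)\<^sup>2"
    using zero_le_power2[of "a - 2 * q + b"] by (simp add: power2_eq_square algebra_simps)
  also have "(q - b)\<^sup>2 \<le> (q - b) * (q + b)"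
    unfolding power2_eq_square using sq by (intro mult_left_mono) auto
  finally have "(a - b)\<^sup>2 \<le> 2 * a\<^sup>2 + 4 * q\<^sup>2 - 4 * (a * q) - 2 * b\<^sup>2"
    by (simp add: power2_eq_square algebra_simps)
  then show ?thesis
    using sq by (simp add: real_sqrt_mult)
qed

text \<open>Put \<open>k = 1 / sqrt w\<close>, \<open>u = sqrt (m / d)\<close> and
  \<open>r = sqrt d\<close>. A quarter of the right side minus the left side factors as
  \<open>(k - u) * (j * (k + u) - r\<^sup>2 * k - u * (r * g))\<close>. The first factor is
  nonnegative by \<open>w * m \<le> d\<close>, the second by \<open>d \<le> j\<close> and
  \<open>sqrt d * g \<le> j\<close>.\<close>

lemma weighted_potential_step:
  fixes w m d j g :: real
  assumes "0 < w" "0 \<le> m" "0 < d" "w * m \<le> d" "d \<le> j" "sqrt d * g \<le> j"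
  shows "m * (4 * j / d - 4 * g / sqrt d) + 4 / sqrt w * (sqrt m * g) + 4 / w * d
       \<le> 4 / sqrt w * sqrt (m * d) + 4 / w * j"
proof -
  define k u r where "k = 1 / sqrt w" and "u = sqrt m / sqrt d" and "r = sqrt d"
  have r: "0 < r" "d = r\<^sup>2" and m: "m = (u * r)\<^sup>2" "sqrt m = u * r" "0 \<le> u" and k: "0 < k" "1 / w = k\<^sup>2"
    using assms by (auto simp: r_def u_def k_def power_divide)
  have "m / d \<le> 1 / w"
    using assms by (simp add: field_simps)
  then have "sqrt (m / d) \<le> sqrt (1 / w)"
    by (rule real_sqrt_le_mono)
  then have "u \<le> k"
    by (simp add: u_def k_def real_sqrt_divide)
  have "u * (r * g) \<le> u * j" "k * r\<^sup>2 \<le> k * j"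
    using assms(5,6) m(3) k(1) unfolding r_def[symmetric] r(2)[symmetric]
    by (auto intro: mult_left_mono)
  then have "0 \<le> j * (k + u) - r\<^sup>2 * k - u * (r * g)"
    by (simp add: algebra_simps)
  with \<open>u \<le> k\<close> have "0 \<le> (k - u) * (j * (k + u) - r\<^sup>2 * k - u * (r * g))"
    by (intro mult_nonneg_nonneg) simp_all
  then have step: "u\<^sup>2 * j - u\<^sup>2 * r * g + k * (u * r * g) + k\<^sup>2 * r\<^sup>2 \<le> k * (u * r\<^sup>2) + k\<^sup>2 * j"
    by (simp add: algebra_simps power2_eq_square)
  have eq1: "m * (4 * j / d - 4 * g / sqrt d) = 4 * (u\<^sup>2 * j - u\<^sup>2 * r * g)"
    unfolding m(1) r(2) using r(1) by (simp add: field_simps power2_eq_square)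
  have eq2: "4 / sqrt w * (sqrt m * g) = 4 * (k * (u * r * g))"
    by (simp add: m(2) k_def)
  have eq3: "4 / sqrt w * sqrt (m * d) = 4 * (k * (u * r\<^sup>2))"
    unfolding real_sqrt_mult m(2) r_def[symmetric] by (simp add: k_def power2_eq_square)
  have eq4: "4 / w * d = 4 * (k\<^sup>2 * r\<^sup>2)" "4 / w * j = 4 * (k\<^sup>2 * j)"
    by (simp_all add: k(2)[symmetric] r(2)[symmetric])
  show ?thesis
    unfolding eq1 eq2 eq3 eq4 using mult_left_mono[OF step, of 4] by (simp add: algebra_simps)
qed

section \<open>Densities of finitely many outputs and the law of the data\<close>

locale mdl_class =
  fixes C :: "'x model set" and w :: "'x model \<Rightarrow> real" and B :: real and x :: "nat \<Rightarrow> 'x"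
  assumes countable_C: "countable C"
    and measurable_model [simp]: "\<And>\<nu> u. \<nu> \<in> C \<Longrightarrow> \<nu> u \<in> borel_measurable borel"
    and model_bounds: "\<And>\<nu> u y. \<nu> \<in> C \<Longrightarrow> 0 \<le> \<nu> u y \<and> \<nu> u y \<le> B"
    and integral_model: "\<And>\<nu> u. \<nu> \<in> C \<Longrightarrow> (\<integral>y. \<nu> u y \<partial>lborel) = 1"
    and weight_pos: "\<And>\<nu>. \<nu> \<in> C \<Longrightarrow> w \<nu> > 0"
    and has_sum_weight: "(w has_sum 1) C"
begin

text \<open>Histories are functions that are undefined from \<open>n\<close> on. The next output is
  attached as \<open>y(n := z)\<close>, so conditioning on the past becomes iterated
  integration.\<close>

definition L :: "nat \<Rightarrow> (nat \<Rightarrow> real) measure" where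
  "L n = (\<Pi>\<^sub>M i\<in>{..<n}. lborel)"

definition dens :: "'x model \<Rightarrow> nat \<Rightarrow> (nat \<Rightarrow> real) \<Rightarrow> real" where
  "dens \<nu> n y = seq_density \<nu> (map x [0..<n]) (map y [0..<n])"

definition mdl :: "nat \<Rightarrow> (nat \<Rightarrow> real) \<Rightarrow> real" where
  "mdl n y = mdl_density C w (map x [0..<n]) (map y [0..<n])"

lemma model_nonneg: "\<nu> \<in> C \<Longrightarrow> 0 \<le> \<nu> u y"
  using model_bounds by blast

text \<open>A non-integrable function has Bochner integral \<open>0\<close>, so the value
  \<open>1\<close> already gives integrability.\<close>

lemma integrable_model: "\<nu> \<in> C \<Longrightarrow> integrable lborel (\<nu> u)"
  using integral_model[of \<nu> u] not_integrable_integral_eq by fastforce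

lemma nn_integral_model: "\<nu> \<in> C \<Longrightarrow> (\<integral>\<^sup>+z. ennreal (\<nu> u z) \<partial>lborel) = 1"
  by (subst nn_integral_eq_integral) (auto simp: integrable_model integral_model model_nonneg)

lemma dens_prod: "dens \<nu> n y = (\<Prod>i<n. \<nu> (x i) (y i))"
proof -
  have "zip (map x [0..<n]) (map y [0..<n]) = map (\<lambda>i. (x i, y i)) [0..<n]"
    by (auto intro!: nth_equalityI)
  then show ?thesis
    by (simp add: dens_def seq_density_def o_def prod.distinct_set_conv_list[symmetric] atLeast0LessThan)
qed

lemma dens_0 [simp]: "dens \<nu> 0 y = 1"
  by (simp add: dens_prod)

lemma dens_Suc: "dens \<nu> (Suc n) (y(n := z)) = dens \<nu> n y * \<nu> (x n) z"
  by (simp add: dens_prod)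

lemma dens_nonneg: "\<nu> \<in> C \<Longrightarrow> 0 \<le> dens \<nu> n y"
  by (simp add: dens_prod prod_nonneg model_nonneg)

lemma dens_le: "\<nu> \<in> C \<Longrightarrow> dens \<nu> n y \<le> B ^ n"
  using seq_density_bounds[of \<nu> B "map x [0..<n]" "map y [0..<n]"] model_bounds[of \<nu>]
  by (simp add: dens_def)

lemma measurable_dens [measurable]: "\<nu> \<in> C \<Longrightarrow> dens \<nu> n \<in> borel_measurable (L n)"
  unfolding dens_prod[abs_def] L_def
  by (intro borel_measurable_prod measurable_compose[OF measurable_component_singleton]) auto

lemma product_sigma_finite_lborel: "product_sigma_finite (\<lambda>_::nat. lborel :: real measure)"
  by unfold_locales

lemma measurable_fun_upd_L [measurable]:
  "(\<lambda>(y, z). y(n := z)) \<in> L n \<Otimes>\<^sub>M lborel \<rightarrow>\<^sub>M L (Suc n)"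
  unfolding L_def using measurable_add_dim[of n "{..<n}" "\<lambda>_. lborel"] by (simp add: lessThan_Suc)

lemma measurable_fun_upd_L1:
  "y \<in> space (L n) \<Longrightarrow> (\<lambda>z. y(n := z)) \<in> lborel \<rightarrow>\<^sub>M L (Suc n)"
  using measurable_compose[OF measurable_Pair1' measurable_fun_upd_L] by simp

lemma nn_integral_L_Suc:
  assumes "f \<in> borel_measurable (L (Suc n))"
  shows "(\<integral>\<^sup>+y. f y \<partial>L (Suc n)) = (\<integral>\<^sup>+y. \<integral>\<^sup>+z. f (y(n := z)) \<partial>lborel \<partial>L n)"
  using assms product_sigma_finite.product_nn_integral_insert[OF product_sigma_finite_lborel, of "{..<n}" n f]
  by (simp add: L_def lessThan_Suc)

lemma nn_integral_L_0: "(\<integral>\<^sup>+y. f y \<partial>L 0) = f (\<lambda>_. undefined)"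
  by (simp add: L_def PiM_empty nn_integral_count_space_finite)

lemma nn_integral_dens: "\<nu> \<in> C \<Longrightarrow> (\<integral>\<^sup>+y. ennreal (dens \<nu> n y) \<partial>L n) = 1"
proof (induction n)
  case 0
  show ?case by (subst nn_integral_L_0) simp
next
  case (Suc n)
  note [measurable] = measurable_model[OF Suc.prems]
  have "(\<integral>\<^sup>+y. ennreal (dens \<nu> (Suc n) y) \<partial>L (Suc n))
      = (\<integral>\<^sup>+y. \<integral>\<^sup>+z. ennreal (dens \<nu> n y) * ennreal (\<nu> (x n) z) \<partial>lborel \<partial>L n)"
    using Suc.prems by (simp add: nn_integral_L_Suc dens_Suc ennreal_mult dens_nonneg model_nonneg)
  also have "\<dots> = (\<integral>\<^sup>+y. ennreal (dens \<nu> n y) \<partial>L n)"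
    using Suc.prems by (simp add: nn_integral_cmult nn_integral_model)
  finally show ?case using Suc by simp
qed

text \<open>Passing to a density leaves the sigma-algebra of each factor unchanged.\<close>

lemma measurable_density_lborel:
  "f \<in> borel_measurable (\<Pi>\<^sub>M i\<in>I. density lborel (g i)) \<longleftrightarrow> f \<in> borel_measurable (\<Pi>\<^sub>M i\<in>I. lborel)"
  by (intro arg_cong[where f="\<lambda>A. f \<in> A"] measurable_cong_sets sets_PiM_cong) auto

lemma prob_space_model: "\<nu> \<in> C \<Longrightarrow> prob_space (density lborel (\<lambda>z. ennreal (\<nu> u z)))"
  using measurable_model[of \<nu> u, measurable] by (intro prob_spaceI) (simp add: emeasure_density nn_integral_model)

text \<open>A product of measures with densities has the product density; the induction splits off
  the last coordinate on both sides.\<close>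

lemma nn_integral_finite_output_law:
  assumes "\<mu> \<in> C" and "f \<in> borel_measurable (L n)"
  shows "(\<integral>\<^sup>+y. f y \<partial>(\<Pi>\<^sub>M i\<in>{..<n}. density lborel (\<lambda>z. ennreal (\<mu> (x i) z))))
       = (\<integral>\<^sup>+y. ennreal (dens \<mu> n y) * f y \<partial>L n)"
  using assms(2)
proof (induction n arbitrary: f)
  let ?M = "\<lambda>i. density lborel (\<lambda>z. ennreal (\<mu> (x i) z))"
  interpret prob_space "?M i" for i
    by (rule prob_space_model[OF assms(1)])
  interpret product_sigma_finite ?M
    by unfold_locales
  {
    case 0
    then show ?case by (simp add: nn_integral_L_0 PiM_empty nn_integral_count_space_finite)
  next
    case (Suc n)
    note [measurable] = Suc.prems measurable_model[OF assms(1)] measurable_dens[OF assms(1)]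
    interpret sigma_finite_measure lborel by (rule lborel.sigma_finite_measure_axioms)
    have "(\<integral>\<^sup>+y. f y \<partial>(\<Pi>\<^sub>M i\<in>{..<Suc n}. ?M i)) = (\<integral>\<^sup>+y. \<integral>\<^sup>+z. f (y(n := z)) \<partial>?M n \<partial>(\<Pi>\<^sub>M i\<in>{..<n}. ?M i))"
      using Suc.prems by (subst product_nn_integral_insert[symmetric])
        (auto simp: lessThan_Suc L_def measurable_density_lborel)
    also have "\<dots> = (\<integral>\<^sup>+y. \<integral>\<^sup>+z. ennreal (\<mu> (x n) z) * f (y(n := z)) \<partial>lborel \<partial>(\<Pi>\<^sub>M i\<in>{..<n}. ?M i))"
    proof (rule nn_integral_cong)
      fix y assume "y \<in> space (\<Pi>\<^sub>M i\<in>{..<n}. ?M i)"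
      then have "y \<in> space (L n)" by (simp add: L_def space_PiM)
      then show "(\<integral>\<^sup>+z. f (y(n := z)) \<partial>?M n) = (\<integral>\<^sup>+z. ennreal (\<mu> (x n) z) * f (y(n := z)) \<partial>lborel)"
        using measurable_compose[OF measurable_fun_upd_L1 Suc.prems] assms(1)
        by (subst nn_integral_density) auto
    qed
    also have "\<dots> = (\<integral>\<^sup>+y. ennreal (dens \<mu> n y) *
        (\<integral>\<^sup>+z. ennreal (\<mu> (x n) z) * f (y(n := z)) \<partial>lborel) \<partial>L n)"
      by (rule Suc.IH) measurable
    also have "\<dots> = (\<integral>\<^sup>+y. \<integral>\<^sup>+z. ennreal (dens \<mu> (Suc n) (y(n := z))) * f (y(n := z)) \<partial>lborel \<partial>L n)"
    proof (rule nn_integral_cong)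
      fix y assume "y \<in> space (L n)"
      then show "ennreal (dens \<mu> n y) * (\<integral>\<^sup>+z. ennreal (\<mu> (x n) z) * f (y(n := z)) \<partial>lborel)
          = (\<integral>\<^sup>+z. ennreal (dens \<mu> (Suc n) (y(n := z))) * f (y(n := z)) \<partial>lborel)"
        using measurable_compose[OF measurable_fun_upd_L1 Suc.prems] assms(1)
        by (subst nn_integral_cmult[symmetric])
           (auto simp: dens_Suc ennreal_mult dens_nonneg model_nonneg mult.assoc)
    qed
    also have "\<dots> = (\<integral>\<^sup>+y. ennreal (dens \<mu> (Suc n) y) * f y \<partial>L (Suc n))"
      by (subst nn_integral_L_Suc) measurable
    finally show ?case .
  }
qed

text \<open>The first \<open>n\<close> coordinates of the infinite product follow the finite product
  law, so expectations over the past become Lebesgue integrals weighted by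
  \<open>dens \<mu> n\<close>.\<close>

lemma nn_integral_output_law:
  assumes "\<mu> \<in> C" and f: "f \<in> borel_measurable (L n)"
  shows "(\<integral>\<^sup>+y. f (restrict y {..<n}) \<partial>output_law \<mu> x) = (\<integral>\<^sup>+y. ennreal (dens \<mu> n y) * f y \<partial>L n)"
proof -
  let ?M = "\<lambda>i. density lborel (\<lambda>z. ennreal (\<mu> (x i) z))"
  interpret prob_space "?M i" for i
    by (rule prob_space_model[OF assms(1)])
  interpret product_prob_space ?M UNIV
    by unfold_locales
  have "(\<integral>\<^sup>+y. f y \<partial>(\<Pi>\<^sub>M i\<in>{..<n}. ?M i)) = (\<integral>\<^sup>+y. f (restrict y {..<n}) \<partial>output_law \<mu> x)"
    using f by (subst distr_PiM_restrict_finite[symmetric])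
      (auto simp: output_law_def L_def measurable_density_lborel intro!: nn_integral_distr)
  then show ?thesis
    using nn_integral_finite_output_law[OF assms] by simp
qed

section \<open>The MDL density and its total mass\<close>

text \<open>\<open>mdl\<close> is a supremum of reals, which is informative only for a set bounded
  above. A maximizer exists, and it provides the bound, the domination and the attainment at
  once.\<close>

lemma weight_dens_bdd_above: "bdd_above ((\<lambda>\<nu>. w \<nu> * dens \<nu> n y) ` C)"
  and weight_dens_le_mdl: "\<nu> \<in> C \<Longrightarrow> w \<nu> * dens \<nu> n y \<le> mdl n y"
  and mdl_attained: "\<exists>\<nu>\<in>C. mdl n y = w \<nu> * dens \<nu> n y"
proof -
  have "\<exists>\<nu>. is_arg_max (\<lambda>\<nu>. w \<nu> * seq_density \<nu> (map x [0..<n]) (map y [0..<n])) (\<lambda>\<nu>. \<nu> \<in> C) \<nu>"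
    by (rule arg_max_exists[where B = B]) (use model_bounds weight_pos has_sum_weight in auto)
  then obtain \<nu>' where \<nu>': "is_arg_max (\<lambda>\<nu>. w \<nu> * seq_density \<nu> (map x [0..<n]) (map y [0..<n])) (\<lambda>\<nu>. \<nu> \<in> C) \<nu>'" ..
  then have eq: "mdl n y = w \<nu>' * dens \<nu>' n y"
    unfolding mdl_def dens_def by (rule mdl_density_attained)
  have in_C: "\<nu>' \<in> C" and le: "\<And>\<nu>. \<nu> \<in> C \<Longrightarrow> w \<nu> * dens \<nu> n y \<le> w \<nu>' * dens \<nu>' n y"
    using \<nu>' unfolding is_arg_max_def dens_def by (auto simp: not_less)
  show "bdd_above ((\<lambda>\<nu>. w \<nu> * dens \<nu> n y) ` C)" using le by (intro bdd_aboveI2)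
  show "\<nu> \<in> C \<Longrightarrow> w \<nu> * dens \<nu> n y \<le> mdl n y" using le eq by simp
  show "\<exists>\<nu>\<in>C. mdl n y = w \<nu> * dens \<nu> n y" using in_C eq by blast
qed

lemma mdl_nonneg: "0 \<le> mdl n y"
  using mdl_attained[of n y] by (auto simp: weight_pos less_imp_le dens_nonneg)

lemma measurable_mdl [measurable]: "mdl n \<in> borel_measurable (L n)"
  unfolding mdl_def[abs_def] mdl_density_def dens_def[symmetric]
  by (rule borel_measurable_cSUP) (auto simp: countable_C weight_dens_bdd_above)

text \<open>In this form the sum over models can be exchanged with integrals over outputs.\<close>

lemma nn_integral_weight: "(\<integral>\<^sup>+\<nu>. ennreal (w \<nu>) \<partial>count_space C) = 1"
proof -
  have "w summable_on C"
    using has_sum_weight by (auto simp: summable_on_def)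
  then have "Infinite_Sum.abs_summable_on w C"
    by (rule summable_on_iff_abs_summable_on_real[THEN iffD1])
  then have abs: "Infinite_Set_Sum.abs_summable_on w C"
    by (rule abs_summable_equivalent[THEN iffD1])
  show ?thesis
    using infsetsum_infsum[OF abs] infsumI[OF has_sum_weight]
    by (subst nn_integral_conv_infsetsum[OF abs]) (auto simp: weight_pos less_imp_le)
qed

text \<open>The maximum is one of the nonnegative terms of the Bayes mixture.\<close>

lemma mdl_le_mixture: "ennreal (mdl n y) \<le> (\<integral>\<^sup>+\<nu>. ennreal (w \<nu>) * ennreal (dens \<nu> n y) \<partial>count_space C)"
proof -
  obtain \<nu> where \<nu>: "\<nu> \<in> C" "mdl n y = w \<nu> * dens \<nu> n y"
    using mdl_attained by blast
  then have "ennreal (mdl n y) = ennreal (w \<nu>) * ennreal (dens \<nu> n y)"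
    by (simp add: ennreal_mult weight_pos less_imp_le dens_nonneg)
  also have "\<dots> = (\<integral>\<^sup>+\<nu>'. ennreal (w \<nu>) * ennreal (dens \<nu> n y) * indicator {\<nu>} \<nu>' \<partial>count_space C)"
    using \<nu> by (simp add: nn_integral_cmult)
  also have "\<dots> \<le> (\<integral>\<^sup>+\<nu>. ennreal (w \<nu>) * ennreal (dens \<nu> n y) \<partial>count_space C)"
    by (intro nn_integral_mono) (auto simp: indicator_def)
  finally show ?thesis .
qed

text \<open>The mixture that dominates \<open>mdl n\<close> is a convex combination of probability
  densities.\<close>

lemma nn_integral_mdl_le_1: "(\<integral>\<^sup>+y. ennreal (mdl n y) \<partial>L n) \<le> 1"
proof -
  have "(\<integral>\<^sup>+y. ennreal (mdl n y) \<partial>L n)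
      \<le> (\<integral>\<^sup>+y. \<integral>\<^sup>+\<nu>. ennreal (w \<nu>) * ennreal (dens \<nu> n y) \<partial>count_space C \<partial>L n)"
    by (intro nn_integral_mono mdl_le_mixture)
  also have "\<dots> = (\<integral>\<^sup>+\<nu>. \<integral>\<^sup>+y. ennreal (w \<nu>) * ennreal (dens \<nu> n y) \<partial>L n \<partial>count_space C)"
    by (rule nn_integral_count_space_nn_integral) (auto simp: countable_C)
  also have "\<dots> = (\<integral>\<^sup>+\<nu>. ennreal (w \<nu>) \<partial>count_space C)"
    by (intro nn_integral_cong) (simp add: nn_integral_cmult nn_integral_dens)
  finally show ?thesis by (simp add: nn_integral_weight)
qed

section \<open>Mass and affinity of the next output\<close>

text \<open>The total mass of the dynamic predictor is \<open>mass t y / mdl t y\<close>.\<close>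

definition mass :: "nat \<Rightarrow> (nat \<Rightarrow> real) \<Rightarrow> real" where
  "mass t y = (\<integral>z. mdl (Suc t) (y(t := z)) \<partial>lborel)"

text \<open>The Hellinger affinity (Bhattacharyya coefficient) of the true next density and the
  unnormalized MDL density. Division by \<open>sqrt (mdl t y)\<close> gives the affinity with the
  dynamic predictor.\<close>

definition affinity :: "'x model \<Rightarrow> nat \<Rightarrow> (nat \<Rightarrow> real) \<Rightarrow> real" where
  "affinity \<mu> t y = (\<integral>z. sqrt (\<mu> (x t) z * mdl (Suc t) (y(t := z))) \<partial>lborel)"

lemma measurable_mdl_upd:
  assumes "y \<in> space (L t)"
  shows "(\<lambda>z. mdl (Suc t) (y(t := z))) \<in> borel_measurable lborel"
  using measurable_compose[OF measurable_fun_upd_L1[OF assms] measurable_mdl] by simp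

text \<open>The bound on the total mass would give this only for almost every history. Here every
  history is covered: the past contributes at most \<open>B ^ t\<close> in each model, so the
  mixture integrates to at most \<open>B ^ t\<close>.\<close>

lemma integrable_mdl_upd:
  assumes y: "y \<in> space (L t)"
  shows "integrable lborel (\<lambda>z. mdl (Suc t) (y(t := z)))"
proof (rule integrableI_nonneg)
  have "(\<integral>\<^sup>+z. ennreal (mdl (Suc t) (y(t := z))) \<partial>lborel)
      \<le> (\<integral>\<^sup>+z. \<integral>\<^sup>+\<nu>. ennreal (w \<nu>) * ennreal (dens \<nu> (Suc t) (y(t := z))) \<partial>count_space C \<partial>lborel)"
    by (intro nn_integral_mono mdl_le_mixture)
  also have "\<dots> \<le> (\<integral>\<^sup>+z. \<integral>\<^sup>+\<nu>. ennreal (w \<nu>) * (ennreal (B ^ t) * ennreal (\<nu> (x t) z)) \<partial>count_space C \<partial>lborel)"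
    by (intro nn_integral_mono mult_left_mono)
       (auto simp: dens_Suc ennreal_mult dens_nonneg model_nonneg dens_le intro!: mult_right_mono ennreal_leI)
  also have "\<dots> = (\<integral>\<^sup>+\<nu>. \<integral>\<^sup>+z. ennreal (w \<nu>) * (ennreal (B ^ t) * ennreal (\<nu> (x t) z)) \<partial>lborel \<partial>count_space C)"
    by (intro nn_integral_count_space_nn_integral countable_C borel_measurable_times_ennreal
        measurable_compose[OF _ measurable_ennreal]) simp_all
  also have "\<dots> = (\<integral>\<^sup>+\<nu>. ennreal (w \<nu>) * ennreal (B ^ t) \<partial>count_space C)"
  proof (rule nn_integral_cong)
    fix \<nu> assume "\<nu> \<in> space (count_space C)"
    then have \<nu>: "\<nu> \<in> C" by simp
    note [measurable] = measurable_model[OF \<nu>]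
    show "(\<integral>\<^sup>+z. ennreal (w \<nu>) * (ennreal (B ^ t) * ennreal (\<nu> (x t) z)) \<partial>lborel)
        = ennreal (w \<nu>) * ennreal (B ^ t)"
      using \<nu> by (simp add: nn_integral_cmult nn_integral_model)
  qed
  also have "\<dots> < \<infinity>"
    by (simp add: nn_integral_multc nn_integral_weight)
  finally show "(\<integral>\<^sup>+z. ennreal (mdl (Suc t) (y(t := z))) \<partial>lborel) < \<infinity>" .
qed (use measurable_mdl_upd[OF y] mdl_nonneg in auto)

text \<open>The geometric mean is dominated by the sum of two integrable functions.\<close>

lemma integrable_sqrt_model_mdl:
  assumes "\<mu> \<in> C" and y: "y \<in> space (L t)"
  shows "integrable lborel (\<lambda>z. sqrt (\<mu> (x t) z * mdl (Suc t) (y(t := z))))"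
proof (rule Bochner_Integration.integrable_bound)
  show "integrable lborel (\<lambda>z. \<mu> (x t) z + mdl (Suc t) (y(t := z)))"
    using integrable_model integrable_mdl_upd assms by simp
  show "(\<lambda>z. sqrt (\<mu> (x t) z * mdl (Suc t) (y(t := z)))) \<in> borel_measurable lborel"
    using measurable_model[OF assms(1)] measurable_mdl_upd[OF y]
    by (intro measurable_compose[OF _ borel_measurable_sqrt] borel_measurable_times) simp_all
  have "sqrt (a * b) \<le> a + b" if "0 \<le> a" "0 \<le> b" for a b :: real
    using arith_geo_mean_sqrt[OF that] that by argo
  then show "AE z in lborel. norm (sqrt (\<mu> (x t) z * mdl (Suc t) (y(t := z))))
      \<le> norm (\<mu> (x t) z + mdl (Suc t) (y(t := z)))"
    using model_nonneg[OF assms(1)] mdl_nonneg by simp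
qed

text \<open>The model that attains \<open>mdl t y\<close> remains a candidate after any next output
  \<open>z\<close>, and its weighted density integrates over \<open>z\<close> to
  \<open>mdl t y\<close>.\<close>

lemma mdl_le_mass:
  assumes y: "y \<in> space (L t)"
  shows "mdl t y \<le> mass t y"
proof -
  obtain \<nu> where \<nu>: "\<nu> \<in> C" "mdl t y = w \<nu> * dens \<nu> t y"
    using mdl_attained by blast
  have "mdl t y = (\<integral>z. w \<nu> * dens \<nu> t y * \<nu> (x t) z \<partial>lborel)"
    using \<nu> by (simp add: integral_model)
  also have "\<dots> \<le> mass t y"
    unfolding mass_def
  proof (intro integral_mono integrable_mdl_upd[OF y])
    show "w \<nu> * dens \<nu> t y * \<nu> (x t) z \<le> mdl (Suc t) (y(t := z))" for z
      using weight_dens_le_mdl[OF \<nu>(1), of "Suc t" "y(t := z)"] by (simp add: dens_Suc mult.assoc)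
  qed (simp add: integrable_model \<nu>(1))
  finally show ?thesis .
qed

lemma affinity_nonneg: "\<mu> \<in> C \<Longrightarrow> 0 \<le> affinity \<mu> t y"
  unfolding affinity_def by (intro Bochner_Integration.integral_nonneg) (auto simp: model_nonneg mdl_nonneg)

text \<open>The inequality of arithmetic and geometric means under the integral gives the average of
  \<open>mdl t y\<close> and \<open>mass t y\<close>, which \<open>mdl_le_mass\<close> bounds by
  \<open>mass t y\<close>. This is the last hypothesis of
  \<open>weighted_potential_step\<close>.\<close>

lemma affinity_le_mass:
  assumes \<mu>: "\<mu> \<in> C" and y: "y \<in> space (L t)"
  shows "sqrt (mdl t y) * affinity \<mu> t y \<le> mass t y"
proof -
  have amgm: "sqrt d * sqrt (a * b) \<le> (a * d + b) / 2" if "0 \<le> a" "0 \<le> b" "0 \<le> d" for a b d :: real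
    using arith_geo_mean_sqrt[of "a * d" b] that by (simp add: real_sqrt_mult mult_ac)
  have "sqrt (mdl t y) * affinity \<mu> t y
      = (\<integral>z. sqrt (mdl t y) * sqrt (\<mu> (x t) z * mdl (Suc t) (y(t := z))) \<partial>lborel)"
    by (simp add: affinity_def)
  also have "\<dots> \<le> (\<integral>z. (\<mu> (x t) z * mdl t y + mdl (Suc t) (y(t := z))) / 2 \<partial>lborel)"
    using integrable_model integrable_mdl_upd integrable_sqrt_model_mdl assms
    by (intro integral_mono amgm) (auto simp: model_nonneg mdl_nonneg)
  also have "\<dots> = (mdl t y + mass t y) / 2"
    using integrable_model integrable_mdl_upd assms by (simp add: integral_model mass_def)
  also have "\<dots> \<le> mass t y"
    using mdl_le_mass[OF y] by simp
  finally show ?thesis .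
qed

lemma measurable_mdl_fun_upd [measurable]:
  "(\<lambda>(y, z). mdl (Suc t) (y(t := z))) \<in> borel_measurable (L t \<Otimes>\<^sub>M lborel)"
  using measurable_compose[OF measurable_fun_upd_L measurable_mdl] by (simp add: split_beta')

lemma measurable_mass [measurable]: "mass t \<in> borel_measurable (L t)"
  unfolding mass_def[abs_def]
  by (rule lborel.borel_measurable_lebesgue_integral) (rule measurable_mdl_fun_upd)

lemma measurable_affinity [measurable]: "\<mu> \<in> C \<Longrightarrow> affinity \<mu> t \<in> borel_measurable (L t)"
proof -
  assume "\<mu> \<in> C"
  then have "(\<lambda>p. \<mu> (x t) (snd p)) \<in> borel_measurable (L t \<Otimes>\<^sub>M lborel)"
    by (intro measurable_compose[OF measurable_snd]) (simp add: measurable_model)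
  then have "(\<lambda>(y, z). sqrt (\<mu> (x t) z * mdl (Suc t) (y(t := z)))) \<in> borel_measurable (L t \<Otimes>\<^sub>M lborel)"
    using measurable_mdl_fun_upd unfolding split_beta'
    by (intro measurable_compose[OF _ borel_measurable_sqrt] borel_measurable_times)
  then show "affinity \<mu> t \<in> borel_measurable (L t)"
    unfolding affinity_def[abs_def] by (rule lborel.borel_measurable_lebesgue_integral)
qed

section \<open>The Hellinger distance at one step\<close>

text \<open>An upper bound for the Hellinger distance that is measurable in the history, whatever the
  predictor. The value \<open>\<top>\<close> is harmless: \<open>mdl t y = 0\<close> forces \<open>dens \<mu> t y = 0\<close>, and \<open>0 * \<top> = 0\<close>.\<close>

definition hellinger_bound :: "'x model \<Rightarrow> nat \<Rightarrow> (nat \<Rightarrow> real) \<Rightarrow> ennreal" where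
  "hellinger_bound \<mu> t y = (if mdl t y = 0 then \<top>
     else ennreal (4 * mass t y / mdl t y - 4 * affinity \<mu> t y / sqrt (mdl t y)))"

lemma measurable_hellinger_bound [measurable]:
  "\<mu> \<in> C \<Longrightarrow> hellinger_bound \<mu> t \<in> borel_measurable (L t)"
proof -
  assume "\<mu> \<in> C"
  note [measurable] = measurable_affinity[OF this]
  show "hellinger_bound \<mu> t \<in> borel_measurable (L t)"
    unfolding hellinger_bound_def[abs_def] by measurable
qed

text \<open>Integrate \<open>hellinger_dominated_pointwise\<close> with the dynamic prediction
  \<open>q\<close> in the role of \<open>f\<close>. The constant \<open>2\<close> from the mass of
  \<open>\<mu>\<close> is absorbed by \<open>p\<close> having mass at least
  \<open>1\<close>.\<close>

lemma hellinger_le_bound: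
  assumes \<mu>: "\<mu> \<in> C" and y: "y \<in> space (L t)"
    and [measurable]: "p \<in> borel_measurable borel"
    and p: "mdl t y \<noteq> 0 \<Longrightarrow> (\<forall>z. 0 \<le> p z \<and> p z \<le> mdl (Suc t) (y(t := z)) / mdl t y) \<and> 1 \<le> (\<integral>z. p z \<partial>lborel)"
  shows "(\<integral>\<^sup>+z. ennreal ((sqrt (\<mu> (x t) z) - sqrt (p z))\<^sup>2) \<partial>lborel) \<le> hellinger_bound \<mu> t y"
proof (cases "mdl t y = 0")
  case True
  then show ?thesis by (simp add: hellinger_bound_def)
next
  case False
  define q where "q z = mdl (Suc t) (y(t := z)) / mdl t y" for z
  define F where "F z = 2 * \<mu> (x t) z + 4 * q z - 4 * sqrt (\<mu> (x t) z * q z) - 2 * p z" for z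
  note p = p[OF False]
  have q: "integrable lborel q" "(\<integral>z. q z \<partial>lborel) = mass t y / mdl t y"
    using integrable_mdl_upd[OF y] by (auto simp: q_def[abs_def] mass_def)
  have int_p: "integrable lborel p"
  proof (rule Bochner_Integration.integrable_bound[OF q(1)])
    have "norm (p z) \<le> norm (q z)" for z
      using p[THEN conjunct1, rule_format, of z] unfolding q_def by (simp add: mdl_nonneg)
    then show "AE z in lborel. norm (p z) \<le> norm (q z)"
      by simp
  qed simp
  have sqrt_q: "sqrt (\<mu> (x t) z * q z) = sqrt (\<mu> (x t) z * mdl (Suc t) (y(t := z))) / sqrt (mdl t y)" for z
    by (simp add: q_def real_sqrt_divide)
  note int = integrable_model[OF \<mu>] q(1) int_p integrable_sqrt_model_mdl[OF \<mu> y]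
  have F: "(sqrt (\<mu> (x t) z) - sqrt (p z))\<^sup>2 \<le> F z" for z
    unfolding F_def using p model_nonneg[OF \<mu>]
    by (intro hellinger_dominated_pointwise) (auto simp: q_def)
  have int_F: "integrable lborel F"
    unfolding F_def[abs_def] sqrt_q using int by auto
  have "(\<integral>\<^sup>+z. ennreal ((sqrt (\<mu> (x t) z) - sqrt (p z))\<^sup>2) \<partial>lborel) \<le> (\<integral>\<^sup>+z. ennreal (F z) \<partial>lborel)"
    by (intro nn_integral_mono ennreal_leI F)
  \<comment> \<open>\<open>F\<close> dominates a square and is therefore nonnegative, so its two
    integrals agree.\<close>
  also have "\<dots> = ennreal (\<integral>z. F z \<partial>lborel)"
    using order_trans[OF zero_le_power2 F] int_F by (intro nn_integral_eq_integral) auto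
  also have "(\<integral>z. F z \<partial>lborel) = 2 + 4 * (mass t y / mdl t y)
      - 4 * (affinity \<mu> t y / sqrt (mdl t y)) - 2 * (\<integral>z. p z \<partial>lborel)"
    unfolding F_def sqrt_q using int by (simp add: integral_model[OF \<mu>] q(2) affinity_def)
  also have "ennreal \<dots> \<le> hellinger_bound \<mu> t y"
    using False p by (auto simp: hellinger_bound_def intro!: ennreal_leI)
  finally show ?thesis .
qed

section \<open>The telescoping sum\<close>

text \<open>The Hellinger affinity of the joint \<open>\<mu>\<close>-density and the MDL density of
  the first \<open>n\<close> outputs. Together with \<open>total_mass\<close> it forms the potential
  that telescopes.\<close>

definition overlap :: "'x model \<Rightarrow> nat \<Rightarrow> ennreal" where
  "overlap \<mu> n = (\<integral>\<^sup>+y. ennreal (sqrt (dens \<mu> n y * mdl n y)) \<partial>L n)"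

definition total_mass :: "nat \<Rightarrow> ennreal" where
  "total_mass n = (\<integral>\<^sup>+y. ennreal (mdl n y) \<partial>L n)"

text \<open>\<open>L 0\<close> is a point mass and \<open>mdl 0\<close> is constant, so the bound on
  the integral is a bound on the value.\<close>

lemma mdl_0_le_1: "mdl 0 y \<le> 1"
proof -
  have "mdl 0 y = mdl 0 (\<lambda>_. undefined)"
    by (simp add: mdl_def)
  then show ?thesis
    using nn_integral_mdl_le_1[of 0] by (simp add: nn_integral_L_0)
qed

lemma weight_le_1: "\<nu> \<in> C \<Longrightarrow> w \<nu> \<le> 1"
  using weight_dens_le_mdl[of \<nu> 0 undefined] mdl_0_le_1[of undefined] by simp

text \<open>The density of the past factors out of the integral over the last output, which leaves
  the affinity.\<close>

lemma overlap_Suc: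
  assumes \<mu>: "\<mu> \<in> C"
  shows "overlap \<mu> (Suc t) = (\<integral>\<^sup>+y. ennreal (sqrt (dens \<mu> t y) * affinity \<mu> t y) \<partial>L t)"
proof -
  have "overlap \<mu> (Suc t) = (\<integral>\<^sup>+y. \<integral>\<^sup>+z. ennreal (sqrt (dens \<mu> t y) *
      sqrt (\<mu> (x t) z * mdl (Suc t) (y(t := z)))) \<partial>lborel \<partial>L t)"
    unfolding overlap_def
    using \<mu> by (subst nn_integral_L_Suc) (simp_all add: dens_Suc real_sqrt_mult mult.assoc)
  also have "\<dots> = (\<integral>\<^sup>+y. ennreal (sqrt (dens \<mu> t y) * affinity \<mu> t y) \<partial>L t)"
  proof (rule nn_integral_cong)
    fix y assume "y \<in> space (L t)"
    then show "(\<integral>\<^sup>+z. ennreal (sqrt (dens \<mu> t y) * sqrt (\<mu> (x t) z * mdl (Suc t) (y(t := z)))) \<partial>lborel)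
        = ennreal (sqrt (dens \<mu> t y) * affinity \<mu> t y)"
      using integrable_sqrt_model_mdl[OF \<mu>]
      by (subst nn_integral_eq_integral)
         (simp_all add: affinity_def model_nonneg[OF \<mu>] mdl_nonneg dens_nonneg[OF \<mu>])
  qed
  finally show ?thesis .
qed

lemma total_mass_Suc: "total_mass (Suc t) = (\<integral>\<^sup>+y. ennreal (mass t y) \<partial>L t)"
proof -
  have "total_mass (Suc t) = (\<integral>\<^sup>+y. \<integral>\<^sup>+z. ennreal (mdl (Suc t) (y(t := z))) \<partial>lborel \<partial>L t)"
    unfolding total_mass_def by (subst nn_integral_L_Suc) simp_all
  also have "\<dots> = (\<integral>\<^sup>+y. ennreal (mass t y) \<partial>L t)"
    unfolding mass_def
    by (intro nn_integral_cong nn_integral_eq_integral integrable_mdl_upd AE_I2 mdl_nonneg)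
  finally show ?thesis .
qed

text \<open>This is \<open>weighted_potential_step\<close> integrated over histories, with
  \<open>m\<close>, \<open>d\<close>, \<open>j\<close>, \<open>g\<close> equal to
  \<open>dens\<close>, \<open>mdl\<close>, \<open>mass\<close>, \<open>affinity\<close>. All terms
  are moved to the side where they are positive, since subtraction in \<open>ennreal\<close> is
  truncated.\<close>

lemma hellinger_bound_step:
  assumes \<mu>: "\<mu> \<in> C"
  shows "(\<integral>\<^sup>+y. ennreal (dens \<mu> t y) * hellinger_bound \<mu> t y \<partial>L t)
       + ennreal (4 / sqrt (w \<mu>)) * overlap \<mu> (Suc t) + ennreal (4 / w \<mu>) * total_mass t
     \<le> ennreal (4 / sqrt (w \<mu>)) * overlap \<mu> t + ennreal (4 / w \<mu>) * total_mass (Suc t)"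
proof -
  note [measurable] = measurable_dens[OF \<mu>] measurable_affinity[OF \<mu>] measurable_hellinger_bound[OF \<mu>]
  have w: "0 < w \<mu>" by (rule weight_pos[OF \<mu>])
  have pointwise: "ennreal (dens \<mu> t y) * hellinger_bound \<mu> t y
       + ennreal (4 / sqrt (w \<mu>)) * ennreal (sqrt (dens \<mu> t y) * affinity \<mu> t y)
       + ennreal (4 / w \<mu>) * ennreal (mdl t y)
     \<le> ennreal (4 / sqrt (w \<mu>)) * ennreal (sqrt (dens \<mu> t y * mdl t y)) + ennreal (4 / w \<mu>) * ennreal (mass t y)"
    (is "?lhs \<le> ?rhs") if y: "y \<in> space (L t)" for y
  proof (cases "mdl t y = 0")
    case True
    then have "dens \<mu> t y = 0"
      using weight_dens_le_mdl[OF \<mu>, of t y] w dens_nonneg[OF \<mu>, of t y]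
      by (simp add: mult_le_0_iff)
    then show ?thesis using True by simp
  next
    case False
    define e where "e = 4 * mass t y / mdl t y - 4 * affinity \<mu> t y / sqrt (mdl t y)"
    have bound: "hellinger_bound \<mu> t y = ennreal e"
      using False by (simp add: hellinger_bound_def e_def)
    have pos: "0 < mdl t y" using False mdl_nonneg[of t y] by simp
    note nonneg = dens_nonneg[OF \<mu>, of t y] affinity_nonneg[OF \<mu>, of t y] order_trans[OF mdl_nonneg mdl_le_mass[OF y]]
    \<comment> \<open>In this form \<open>affinity_le_mass\<close> shows \<open>0 \<le> e\<close>,
      so that \<open>ennreal e\<close> truncates nothing.\<close>
    have "4 * affinity \<mu> t y / sqrt (mdl t y) = 4 * (sqrt (mdl t y) * affinity \<mu> t y) / mdl t y"
      using pos by (simp add: field_simps)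
    then have e: "0 \<le> e"
      using affinity_le_mass[OF \<mu> y] pos by (simp add: e_def divide_right_mono)
    have "?lhs = ennreal (dens \<mu> t y * e + 4 / sqrt (w \<mu>) * (sqrt (dens \<mu> t y) * affinity \<mu> t y) + 4 / w \<mu> * mdl t y)"
      unfolding bound using e nonneg pos w by (simp flip: ennreal_mult' ennreal_plus)
    also have "\<dots> \<le> ennreal (4 / sqrt (w \<mu>) * sqrt (dens \<mu> t y * mdl t y) + 4 / w \<mu> * mass t y)"
      unfolding e_def using nonneg pos w weight_dens_le_mdl[OF \<mu>] mdl_le_mass[OF y] affinity_le_mass[OF \<mu> y]
      by (intro ennreal_leI weighted_potential_step) auto
    also have "\<dots> = ?rhs"
      using nonneg pos w by (simp flip: ennreal_mult' ennreal_plus)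
    finally show ?thesis .
  qed
  have "(\<integral>\<^sup>+y. ennreal (dens \<mu> t y) * hellinger_bound \<mu> t y
        + ennreal (4 / sqrt (w \<mu>)) * ennreal (sqrt (dens \<mu> t y) * affinity \<mu> t y)
        + ennreal (4 / w \<mu>) * ennreal (mdl t y) \<partial>L t)
      \<le> (\<integral>\<^sup>+y. ennreal (4 / sqrt (w \<mu>)) * ennreal (sqrt (dens \<mu> t y * mdl t y))
        + ennreal (4 / w \<mu>) * ennreal (mass t y) \<partial>L t)"
    by (rule nn_integral_mono) (rule pointwise)
  then show ?thesis
    unfolding overlap_Suc[OF \<mu>] total_mass_Suc overlap_def[of \<mu> t] total_mass_def[of t]
    by (simp add: nn_integral_add nn_integral_cmult)
qed

text \<open>Summing \<open>hellinger_bound_step\<close> leaves only \<open>overlap\<close> at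
  \<open>0\<close> and \<open>total_mass\<close> at \<open>n\<close>, both at most \<open>1\<close>.
  The bound is free of \<open>n\<close>, so it passes to the infinite series.\<close>

lemma hellinger_bound_sum:
  assumes \<mu>: "\<mu> \<in> C"
  shows "(\<Sum>t<n. \<integral>\<^sup>+y. ennreal (dens \<mu> t y) * hellinger_bound \<mu> t y \<partial>L t) \<le> ennreal (8 * inverse (w \<mu>))"
proof -
  let ?a = "\<lambda>t. \<integral>\<^sup>+y. ennreal (dens \<mu> t y) * hellinger_bound \<mu> t y \<partial>L t"
  let ?G = "\<lambda>n. ennreal (4 / sqrt (w \<mu>)) * overlap \<mu> n"
  let ?I = "\<lambda>n. ennreal (4 / w \<mu>) * total_mass n"
  have w: "0 < w \<mu>" "w \<mu> \<le> 1" by (simp_all add: weight_pos weight_le_1 \<mu>)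
  have mass_le: "total_mass n \<le> 1" for n
    unfolding total_mass_def by (rule nn_integral_mdl_le_1)
  then have fin: "?I n \<noteq> \<top>" for n
    using le_less_trans[OF mass_le, of \<top> n] by (simp add: ennreal_mult_eq_top_iff)
  have "sum ?a {..<n} + ?G n + ?I 0 \<le> ?G 0 + ?I n"
  proof (induction n)
    case 0
    show ?case by simp
  next
    case (Suc n)
    \<comment> \<open>\<open>?I n\<close> is added on both sides in place of a subtraction. It is
      finite, so it can be cancelled at the end.\<close>
    have "?I n + (sum ?a {..<Suc n} + ?G (Suc n) + ?I 0)
        = sum ?a {..<n} + (?a n + ?G (Suc n) + ?I n) + ?I 0"
      by (simp add: ac_simps)
    also have "\<dots> \<le> sum ?a {..<n} + (?G n + ?I (Suc n)) + ?I 0"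
      by (intro add_right_mono add_left_mono hellinger_bound_step[OF \<mu>])
    also have "\<dots> = (sum ?a {..<n} + ?G n + ?I 0) + ?I (Suc n)"
      by (simp add: ac_simps)
    also have "\<dots> \<le> (?G 0 + ?I n) + ?I (Suc n)"
      by (intro add_mono Suc.IH) auto
    finally have "?I n + (sum ?a {..<Suc n} + ?G (Suc n) + ?I 0) \<le> ?I n + (?G 0 + ?I (Suc n))"
      by (simp add: ac_simps)
    then show ?case
      using fin[of n] by (simp add: ennreal_add_left_cancel_le)
  qed
  then have "sum ?a {..<n} \<le> ?G 0 + ?I n"
    by (rule order_trans[rotated]) (simp add: add.assoc)
  also have "\<dots> \<le> ennreal (4 / sqrt (w \<mu>)) * 1 + ennreal (4 / w \<mu>) * 1"
    using mdl_0_le_1 by (intro add_mono mult_left_mono mass_le) (auto simp: overlap_def nn_integral_L_0)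
  also have "\<dots> = ennreal (4 / sqrt (w \<mu>) + 4 / w \<mu>)"
    using w by (simp add: ennreal_plus)
  also have "\<dots> \<le> ennreal (8 * inverse (w \<mu>))"
  proof (rule ennreal_leI)
    \<comment> \<open>As weights are at most \<open>1\<close>, the term with the square root is no
      larger than the other one, whence \<open>4 + 4 = 8\<close>.\<close>
    have "w \<mu> \<le> sqrt (w \<mu>)"
      using w by (intro real_le_rsqrt) (simp add: power2_eq_square mult_left_le)
    then have "4 / sqrt (w \<mu>) \<le> 4 / w \<mu>"
      using w by (intro divide_left_mono) auto
    then show "4 / sqrt (w \<mu>) + 4 / w \<mu> \<le> 8 * inverse (w \<mu>)"
      by (simp add: divide_inverse)
  qed
  finally show ?thesis .
qed

section \<open>The three predictors\<close>

text \<open>Each inner integral is replaced by \<open>hellinger_bound\<close> of the history, a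
  measurable function of the first \<open>t\<close> outputs, whose expectation
  \<open>nn_integral_output_law\<close> evaluates.\<close>

lemma hellinger_sum_le:
  assumes \<mu>: "\<mu> \<in> C"
    and meas: "\<And>t y. y \<in> space (L t) \<Longrightarrow> \<psi> (map x [0..<Suc t]) (map y [0..<t]) \<in> borel_measurable borel"
    and dominated: "\<And>t y z. y \<in> space (L t) \<Longrightarrow> 0 < mdl t y \<Longrightarrow>
      0 \<le> \<psi> (map x [0..<Suc t]) (map y [0..<t]) z \<and>
      \<psi> (map x [0..<Suc t]) (map y [0..<t]) z \<le> mdl (Suc t) (y(t := z)) / mdl t y"
    and mass: "\<And>t y. y \<in> space (L t) \<Longrightarrow> 0 < mdl t y \<Longrightarrow>
      1 \<le> (\<integral>z. \<psi> (map x [0..<Suc t]) (map y [0..<t]) z \<partial>lborel)"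
  shows "hellinger_sum x \<mu> \<psi> \<le> ennreal (8 * inverse (w \<mu>))"
proof -
  have "hellinger_sum x \<mu> \<psi>
      \<le> (\<Sum>t. \<integral>\<^sup>+y. hellinger_bound \<mu> t (restrict y {..<t}) \<partial>output_law \<mu> x)"
    unfolding hellinger_sum_def
  proof (intro suminf_le nn_integral_mono summableI)
    fix t and y :: "nat \<Rightarrow> real"
    let ?y = "restrict y {..<t}"
    have y: "?y \<in> space (L t)"
      by (simp add: L_def space_PiM)
    \<comment> \<open>The list of past outputs reads only the indices below \<open>t\<close>, so the
      infinite sequence may be restricted.\<close>
    have hist: "map y [0..<t] = map ?y [0..<t]"
      by simp
    have pos: "0 < mdl t ?y" if "mdl t ?y \<noteq> 0"
      using that mdl_nonneg[of t ?y] by linarith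
    show "(\<integral>\<^sup>+z. ennreal ((sqrt (model_pred \<mu> (map x [0..<Suc t]) (map y [0..<t]) z)
        - sqrt (\<psi> (map x [0..<Suc t]) (map y [0..<t]) z))\<^sup>2) \<partial>lborel) \<le> hellinger_bound \<mu> t ?y"
      using hellinger_le_bound[OF \<mu> y meas[OF y]] dominated[OF y pos] mass[OF y pos]
      unfolding hist[symmetric] model_pred_def by simp
  qed
  also have "\<dots> = (\<Sum>t. \<integral>\<^sup>+y. ennreal (dens \<mu> t y) * hellinger_bound \<mu> t y \<partial>L t)"
    using \<mu> by (intro suminf_cong nn_integral_output_law) auto
  also have "\<dots> \<le> ennreal (8 * inverse (w \<mu>))"
    using hellinger_bound_sum[OF \<mu>] by (intro suminf_le_const summableI)
  finally show ?thesis .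
qed

text \<open>Translates the lists seen by a predictor into the updated histories under the integrals;
  the new output has index \<open>t\<close>.\<close>

lemma mdl_density_snoc:
  "mdl_density C w (map x [0..<Suc t]) (map y [0..<t] @ [z]) = mdl (Suc t) (y(t := z))"
proof -
  have "map (y(t := z)) [0..<Suc t] = map y [0..<t] @ [z]"
    by simp
  then show ?thesis
    unfolding mdl_def by (simp only:)
qed

lemma butlast_inputs: "butlast (map x [0..<Suc t]) = map x [0..<t]"
  by simp

text \<open>Domination holds with equality, and the total mass is at least \<open>1\<close> by
  \<open>mdl_le_mass\<close>.\<close>

lemma hellinger_sum_dynamic:
  assumes \<mu>: "\<mu> \<in> C"
  shows "hellinger_sum x \<mu> (mdl_dynamic C w) \<le> ennreal (8 * inverse (w \<mu>))"
proof (rule hellinger_sum_le[OF \<mu>])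
  have dyn: "mdl_dynamic C w (map x [0..<Suc t]) (map y [0..<t])
      = (\<lambda>z. mdl (Suc t) (y(t := z)) / mdl t y)" for t y
    unfolding mdl_dynamic_def mdl_density_snoc butlast_inputs mdl_def[of t] ..
  fix t y assume y: "y \<in> space (L t)"
  show "mdl_dynamic C w (map x [0..<Suc t]) (map y [0..<t]) \<in> borel_measurable borel"
    unfolding dyn using measurable_mdl_upd[OF y] by simp
  assume "0 < mdl t y"
  then show "1 \<le> (\<integral>z. mdl_dynamic C w (map x [0..<Suc t]) (map y [0..<t]) z \<partial>lborel)"
    unfolding dyn using mdl_le_mass[OF y] by (simp add: mass_def)
  show "0 \<le> mdl_dynamic C w (map x [0..<Suc t]) (map y [0..<t]) z \<and>
      mdl_dynamic C w (map x [0..<Suc t]) (map y [0..<t]) z \<le> mdl (Suc t) (y(t := z)) / mdl t y" for z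
    unfolding dyn by (simp add: mdl_nonneg)
qed

text \<open>The denominator \<open>mass t y\<close> is at least \<open>mdl t y\<close>, so
  normalizing only lowers the dynamic prediction, and the resulting mass is
  \<open>1\<close>.\<close>

lemma hellinger_sum_normalized:
  assumes \<mu>: "\<mu> \<in> C"
  shows "hellinger_sum x \<mu> (mdl_normalized C w) \<le> ennreal (8 * inverse (w \<mu>))"
proof (rule hellinger_sum_le[OF \<mu>])
  have norm: "mdl_normalized C w (map x [0..<Suc t]) (map y [0..<t])
      = (\<lambda>z. mdl (Suc t) (y(t := z)) / mass t y)" for t y
    unfolding mdl_normalized_def mdl_density_snoc mass_def ..
  fix t y assume y: "y \<in> space (L t)"
  show "mdl_normalized C w (map x [0..<Suc t]) (map y [0..<t]) \<in> borel_measurable borel"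
    unfolding norm using measurable_mdl_upd[OF y] by simp
  assume pos: "0 < mdl t y"
  then show "1 \<le> (\<integral>z. mdl_normalized C w (map x [0..<Suc t]) (map y [0..<t]) z \<partial>lborel)"
    unfolding norm using mdl_le_mass[OF y] by (simp add: mass_def)
  show "0 \<le> mdl_normalized C w (map x [0..<Suc t]) (map y [0..<t]) z \<and>
      mdl_normalized C w (map x [0..<Suc t]) (map y [0..<t]) z \<le> mdl (Suc t) (y(t := z)) / mdl t y" for z
    unfolding norm using mdl_le_mass[OF y] pos by (auto simp: mdl_nonneg intro!: divide_left_mono)
qed

text \<open>The model selected from the past still competes after one more observation, so the static
  prediction is at most the dynamic one.\<close>

lemma hellinger_sum_static:
  assumes \<mu>: "\<mu> \<in> C" and est: "mdl_estimator C w est"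
  shows "hellinger_sum x \<mu> (mdl_static est) \<le> ennreal (8 * inverse (w \<mu>))"
proof (rule hellinger_sum_le[OF \<mu>])
  fix t :: nat and y
  define \<nu> where "\<nu> = est (map x [0..<t]) (map y [0..<t])"
  have static: "mdl_static est (map x [0..<Suc t]) (map y [0..<t]) = \<nu> (x t)"
    unfolding mdl_static_def butlast_inputs \<nu>_def by (simp add: fun_eq_iff)
  have arg_max: "is_arg_max (\<lambda>\<nu>. w \<nu> * seq_density \<nu> (map x [0..<t]) (map y [0..<t])) (\<lambda>\<nu>. \<nu> \<in> C) \<nu>"
    using est unfolding mdl_estimator_def \<nu>_def by simp
  then have \<nu>: "\<nu> \<in> C"
    by (simp add: is_arg_max_def)
  have mdl: "mdl t y = w \<nu> * dens \<nu> t y"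
    using mdl_density_attained[OF arg_max] by (simp add: mdl_def dens_def)
  show "mdl_static est (map x [0..<Suc t]) (map y [0..<t]) \<in> borel_measurable borel"
    unfolding static using \<nu> by simp
  show "1 \<le> (\<integral>z. mdl_static est (map x [0..<Suc t]) (map y [0..<t]) z \<partial>lborel)"
    unfolding static using \<nu> by (simp add: integral_model)
  assume "0 < mdl t y"
  \<comment> \<open>With \<open>mdl t y\<close> written as the weighted density of
    \<open>\<nu>\<close>, clearing the denominator leaves the competition of \<open>\<nu>\<close> at
    time \<open>Suc t\<close>.\<close>
  then show "0 \<le> mdl_static est (map x [0..<Suc t]) (map y [0..<t]) z \<and>
      mdl_static est (map x [0..<Suc t]) (map y [0..<t]) z \<le> mdl (Suc t) (y(t := z)) / mdl t y" for z
    unfolding static using weight_dens_le_mdl[OF \<nu>, of "Suc t" "y(t := z)"] model_nonneg[OF \<nu>]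
    by (simp add: mdl dens_Suc field_simps)
qed

end

theorem corollary4:
  fixes C :: "'x model set"
    and w :: "'x model \<Rightarrow> real"
    and B :: real
    and est :: "'x list \<Rightarrow> real list \<Rightarrow> 'x model"
    and \<mu> :: "'x model"
    and x :: "nat \<Rightarrow> 'x"
  assumes "countable C"
    and "B > 0"
    and "\<And>\<nu> u. \<nu> \<in> C \<Longrightarrow> \<nu> u \<in> borel_measurable borel"
    and "\<And>\<nu> u y. \<nu> \<in> C \<Longrightarrow> 0 \<le> \<nu> u y \<and> \<nu> u y \<le> B"
    and "\<And>\<nu> u. \<nu> \<in> C \<Longrightarrow> (\<integral>y. \<nu> u y \<partial>lborel) = 1"
    and "\<And>\<nu>. \<nu> \<in> C \<Longrightarrow> w \<nu> > 0"
    and "(w has_sum 1) C"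
    and "mdl_estimator C w est"
    and "\<mu> \<in> C"
  shows "(\<forall>\<psi> \<in> {mdl_normalized C w, mdl_dynamic C w, mdl_static est}.
            \<exists>R::real. R > 0 \<and> hellinger_sum x \<mu> \<psi> \<le> ennreal R)
       \<and> hellinger_sum x \<mu> (mdl_static est) \<le> ennreal (21 * inverse (w \<mu>))"
proof -
  interpret mdl_class C w B x
    using assms(1,3-7) by unfold_locales
  have w: "0 < w \<mu>"
    using assms(6,9) .
  \<comment> \<open>One constant serves as \<open>R\<close> for all three predictors, and it lies
    below the required \<open>21 * inverse (w \<mu>)\<close>.\<close>
  have "hellinger_sum x \<mu> \<psi> \<le> ennreal (8 * inverse (w \<mu>))"
    if "\<psi> \<in> {mdl_normalized C w, mdl_dynamic C w, mdl_static est}" for \<psi>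
    using that hellinger_sum_normalized[OF assms(9)] hellinger_sum_dynamic[OF assms(9)]
      hellinger_sum_static[OF assms(9,8)] by auto
  moreover have "ennreal (8 * inverse (w \<mu>)) \<le> ennreal (21 * inverse (w \<mu>))"
    using w by (intro ennreal_leI) simp
  moreover have "0 < 8 * inverse (w \<mu>)"
    using w by simp
  ultimately show ?thesis
    by (blast intro: order_trans)
qed

end
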